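(* Given the same input (agents $N$, objects $O$, preference profile $L$ with ties allowed, and order $\sigma$ of the agents), SDMT-1 and SDMT-2 (both defined in the context) match the same set of agents. Furthermore, for each matched agent $i$, the object allocated to $i$ in SDMT-1 is in the same indifference class of $i$ as the object allocated to him in SDMT-2. This equivalence holds for any fixed common order of the objects used in SDMT-2, and it is independent of how SDMT-2 finds the directed paths from an agent $i$ to a labelled agent in the trading graph.
   Context: House Allocation (HA). $N=\{1,\dots,n_1\}$ is a finite set of agents and $O=\{o_1,\dots,o_{n_2}\}$ a finite set of objects. Each agent $i$ has a preference list $L(i)=(C^i_1\succ_i C^i_2\succ_i\cdots)$, an ordered sequence of pairwise disjoint subsets of $O$ (indifference classes); objects in $C^i_k$ are strictly preferred to those in $C^i_l$ for $k<l$, and $i$ is indifferent between objects in the same class; if $C^i_l=\emptyset$ then $C^i_q=\emptyset$ for all $q\ge l$ and $C^i_{n_2+1}=\emptyset$. Objects in $\bigcup_k C^i_k$ are acceptable to $i$ (written $o\in L(i)$). A matching is a set of (agent, acceptable object) pairs in which every agent and every object occurs at most once. SDMT-1, given an order $\sigma$ of the agents: start with the bipartite graph $G=(N\cup O,E)$, $E=\emptyset$, and $\mu=\emptyset$. Process agents in the order $\sigma$. For the current agent $i$, for $\ell=1,2,\dots$ while $C^i_\ell\neq\emptyset$: add the edges $\{(i,o):o\in C^i_\ell\}$ to $E$; if $G$ contains an augmenting path with respect to $\mu$ starting at $i$ (a path from $i$ to an unmatched object, alternating between edges not in $\mu$ and edges in $\mu$), choose any such path, replace $\mu$ by its symmetric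 difference with the path, and go to the next agent; otherwise remove the edges just added and increase $\ell$ by one. Return $\mu$ after all agents are processed. Trading graphs. During SDMT-2 agents are temporarily allocated sets of objects ("own" them), all objects owned by an agent lying in one of his indifference classes. An agent owning more than one object is called labelled, otherwise unlabelled. For an agent $i$, a set $S$ of agents with $i\notin S$, and $B\subseteq L(i)$, the trading graph $TG(i,B,S)$ is the directed graph on $\{i\}\cup S$ built as follows: $i$ points to each agent in $S$ owning an object of $B$; each unlabelled agent $j\in S$ that is pointed to, whose owned object lies in $C^j_k$, points to each agent in $S$ owning an object of $C^j_k$ not owned by $j$; this is repeated for newly pointed-to unlabelled agents until nothing changes. Labelled agents point to nobody. Write $TG(i,a,S)=TG(i,\{a\},S)$. Fix a common strict order on all objects (used only for tie-breaking). Let $H$ be the set of $a\in L(i)$ such that $TG(i,a,S)$ contains a directed path from $i$ to a labelled agent. If $H=\emptyset$, put $\max TG(i,L(i),S)=\emptyset$. Otherwise let $\ell$ be the smallest index with $H\cap C^i_\ell\ne\emptyset$; $\max TG(i,L(i),S)$ is the highest object of $H\cap C^i_\ell$ in the common order. $Trading(i,a,S)$: take a simple directed path $(i=i_0,i_1,\dots,i_k)$ in $TG(i,a,S)$ with only $i_k$ labelled; for $s=0,\dots,k-1$ the object owned by $i_{s+1}$ is given to $i_s$, where $i_{k-1}$ receives the highest object in the common order among those owned by $i_k$ because of which $i_{k-1}$ points to $i_k$; afterwards $i_k$ remains labelled iff he still owns more than one object. SDMT-2, given an order $\sigma$ of the agents: initially all objects are unallocated. Process agents in the order $\sigma$. When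 agent $i$ is processed, let $O_i$ be the set of currently unallocated objects and $S$ the set of previously processed agents. Let $j_1$ be the smallest $j$ with $O_i\cap C^i_j\neq\emptyset$ ($j_1=n_2+1$ if none), and let $j_2$ be the index of the class $C^i_{j_2}$ containing $\max TG(i,L(i),S)$ ($j_2=n_2+1$ if $\max TG(i,L(i),S)=\emptyset$). If $j_1\le j_2$, allocate all objects of $O_i\cap C^i_{j_1}$ to $i$. Otherwise perform $Trading(i,\max TG(i,L(i),S),S)$. After all agents are processed, each labelled agent is matched to the highest object he owns in the common order, each unlabelled agent owning one object is matched to it, and all others are unmatched. *)

theory Defs
  imports Main
begin

text \<open>
  \<open>C i k\<close> is the indifference class \<open>C^i_k\<close>. Classes are numbered from 1; \<open>C i 0\<close> is never used.
\<close>

type_synonym ('a, 'o) preferences = "'a \<Rightarrow> nat \<Rightarrow> 'o set"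

locale house_allocation =
  fixes N :: "'a set" and Ob :: "'o set" and C :: "('a, 'o) preferences"
  assumes finite_N: "finite N"
    and finite_Ob: "finite Ob"
    and class_subset: "\<And>i k. i \<in> N \<Longrightarrow> 1 \<le> k \<Longrightarrow> C i k \<subseteq> Ob"
    and class_disjoint:
      "\<And>i k l. i \<in> N \<Longrightarrow> 1 \<le> k \<Longrightarrow> 1 \<le> l \<Longrightarrow> k \<noteq> l \<Longrightarrow> C i k \<inter> C i l = {}"
    and class_empty:
      "\<And>i l q. i \<in> N \<Longrightarrow> 1 \<le> l \<Longrightarrow> l \<le> q \<Longrightarrow> C i l = {} \<Longrightarrow> C i q = {}"
    and class_last: "\<And>i. i \<in> N \<Longrightarrow> C i (card Ob + 1) = {}"

definition acceptable :: "('a, 'o) preferences \<Rightarrow> 'a \<Rightarrow> 'o set" where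
  "acceptable C i = (\<Union>k\<in>{1..}. C i k)"

definition class_index :: "('a, 'o) preferences \<Rightarrow> 'a \<Rightarrow> 'o \<Rightarrow> nat" where
  "class_index C i x = (THE k. 1 \<le> k \<and> x \<in> C i k)"

text \<open>\<open>(x, y) \<in> r\<close> means that \<open>x\<close> is higher than \<open>y\<close> in the common order of the objects.\<close>

definition highest :: "('o \<times> 'o) set \<Rightarrow> 'o set \<Rightarrow> 'o" where
  "highest r A = (THE x. x \<in> A \<and> (\<forall>y\<in>A - {x}. (x, y) \<in> r))"


section \<open>SDMT-1\<close>

text \<open>
  A path \<open>x0, y0, x1, y1, \<dots>, xm, ym\<close> from an agent to an object is given by its list
  \<open>xs = [x0, \<dots>, xm]\<close> of agents and its list \<open>ys = [y0, \<dots>, ym]\<close> of objects. Its edges from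
  an agent to the next object are \<open>zip xs ys\<close>, those from an object to the next agent are
  \<open>zip (tl xs) ys\<close> (both written as agent-object pairs).
\<close>

definition path_edges :: "'a list \<Rightarrow> 'o list \<Rightarrow> ('a \<times> 'o) set" where
  "path_edges xs ys = set (zip xs ys) \<union> set (zip (tl xs) ys)"

definition augmenting_path ::
  "('a \<times> 'o) set \<Rightarrow> ('a \<times> 'o) set \<Rightarrow> 'a \<Rightarrow> 'a list \<Rightarrow> 'o list \<Rightarrow> bool" where
  "augmenting_path E \<mu> i xs ys \<longleftrightarrow>
     xs \<noteq> [] \<and> length xs = length ys \<and> distinct xs \<and> distinct ys \<and>
     path_edges xs ys \<subseteq> E \<and>
     set (zip xs ys) \<inter> \<mu> = {} \<and> set (zip (tl xs) ys) \<subseteq> \<mu> \<and>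
     hd xs = i \<and> last ys \<notin> Range \<mu>"

text \<open>
  The processing of agent \<open>i\<close> from class \<open>l\<close> on turns the graph \<open>E\<close> and the matching \<open>\<mu>\<close>
  into \<open>E'\<close> and \<open>\<mu>'\<close>. The relation is nondeterministic in the augmenting path.
\<close>

inductive sdmt1_agent ::
  "('a, 'o) preferences \<Rightarrow> 'a \<Rightarrow> nat \<Rightarrow> ('a \<times> 'o) set \<Rightarrow> ('a \<times> 'o) set \<Rightarrow>
   ('a \<times> 'o) set \<Rightarrow> ('a \<times> 'o) set \<Rightarrow> bool"
  for C :: "('a, 'o) preferences" and i :: 'a where
  exhausted: "C i l = {} \<Longrightarrow> sdmt1_agent C i l E \<mu> E \<mu>"
| augment: "\<lbrakk>C i l \<noteq> {}; E' = E \<union> {i} \<times> C i l; augmenting_path E' \<mu> i xs ys\<rbrakk>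
    \<Longrightarrow> sdmt1_agent C i l E \<mu> E' (sym_diff \<mu> (path_edges xs ys))"
| next_class: "\<lbrakk>C i l \<noteq> {}; \<not> (\<exists>xs ys. augmenting_path (E \<union> {i} \<times> C i l) \<mu> i xs ys);
     sdmt1_agent C i (Suc l) E \<mu> E' \<mu>'\<rbrakk> \<Longrightarrow> sdmt1_agent C i l E \<mu> E' \<mu>'"

inductive sdmt1_run ::
  "('a, 'o) preferences \<Rightarrow> 'a list \<Rightarrow> ('a \<times> 'o) set \<Rightarrow> ('a \<times> 'o) set \<Rightarrow>
   ('a \<times> 'o) set \<Rightarrow> ('a \<times> 'o) set \<Rightarrow> bool"
  for C :: "('a, 'o) preferences" where
  finished: "sdmt1_run C [] E \<mu> E \<mu>"
| process: "\<lbrakk>sdmt1_agent C i 1 E \<mu> E' \<mu>'; sdmt1_run C \<sigma> E' \<mu>' E'' \<mu>''\<rbrakk>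
    \<Longrightarrow> sdmt1_run C (i # \<sigma>) E \<mu> E'' \<mu>''"

text \<open>\<open>\<mu>\<close> is a possible output of SDMT-1 for the order \<open>\<sigma>\<close> of the agents.\<close>

definition sdmt1 :: "('a, 'o) preferences \<Rightarrow> 'a list \<Rightarrow> ('a \<times> 'o) set \<Rightarrow> bool" where
  "sdmt1 C \<sigma> \<mu> \<longleftrightarrow> (\<exists>E. sdmt1_run C \<sigma> {} {} E \<mu>)"


section \<open>Trading graphs\<close>

text \<open>\<open>own j\<close> is the set of objects currently owned by agent \<open>j\<close>.\<close>

definition labelled :: "('a \<Rightarrow> 'o set) \<Rightarrow> 'a \<Rightarrow> bool" where
  "labelled own j \<longleftrightarrow> card (own j) > 1"

text \<open>
  In \<open>TG(i,B,S)\<close>, \<open>targets C own i B j\<close> are the objects because of which \<open>j\<close> points to their owners: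
  \<open>B\<close> if \<open>j = i\<close>, and otherwise the objects not owned by \<open>j\<close> in the class of the object of \<open>j\<close>.
\<close>

definition targets ::
  "('a, 'o) preferences \<Rightarrow> ('a \<Rightarrow> 'o set) \<Rightarrow> 'a \<Rightarrow> 'o set \<Rightarrow> 'a \<Rightarrow> 'o set" where
  "targets C own i B j =
     (if j = i then B
      else {y. y \<notin> own j \<and> (\<exists>k\<ge>1. own j \<inter> C j k \<noteq> {} \<and> y \<in> C j k)})"

inductive_set TG ::
  "('a, 'o) preferences \<Rightarrow> ('a \<Rightarrow> 'o set) \<Rightarrow> 'a \<Rightarrow> 'o set \<Rightarrow> 'a set \<Rightarrow> ('a \<times> 'a) set"
  for C :: "('a, 'o) preferences" and own :: "'a \<Rightarrow> 'o set"
    and i :: 'a and B :: "'o set" and S :: "'a set" where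
  initial: "\<lbrakk>j \<in> S; own j \<inter> targets C own i B i \<noteq> {}\<rbrakk> \<Longrightarrow> (i, j) \<in> TG C own i B S"
| onward: "\<lbrakk>(h, j) \<in> TG C own i B S; \<not> labelled own j;
     m \<in> S; own m \<inter> targets C own i B j \<noteq> {}\<rbrakk> \<Longrightarrow> (j, m) \<in> TG C own i B S"

text \<open>The set \<open>H\<close> from the definition of \<open>max TG(i,L(i),S)\<close>.\<close>

definition tradable ::
  "('a, 'o) preferences \<Rightarrow> ('a \<Rightarrow> 'o set) \<Rightarrow> 'a \<Rightarrow> 'a set \<Rightarrow> 'o set" where
  "tradable C own i S =
     {a \<in> acceptable C i. \<exists>j. (i, j) \<in> (TG C own i {a} S)\<^sup>* \<and> labelled own j}"

text \<open>\<open>max TG(i,L(i),S)\<close>, with \<open>None\<close> for the value \<open>\<emptyset>\<close>.\<close>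

definition max_TG ::
  "('a, 'o) preferences \<Rightarrow> ('o \<times> 'o) set \<Rightarrow> ('a \<Rightarrow> 'o set) \<Rightarrow> 'a \<Rightarrow> 'a set \<Rightarrow> 'o option" where
  "max_TG C r own i S =
     (let H = tradable C own i S in
      if H = {} then None
      else Some (highest r (H \<inter> C i (LEAST l. 1 \<le> l \<and> H \<inter> C i l \<noteq> {}))))"

text \<open>
  \<open>Trading(i,a,S)\<close> turns \<open>own\<close> into \<open>own'\<close>. The relation is nondeterministic in the
  path \<open>p = [i0, \<dots>, ik]\<close>.
\<close>

definition trading ::
  "('a, 'o) preferences \<Rightarrow> ('o \<times> 'o) set \<Rightarrow> ('a \<Rightarrow> 'o set) \<Rightarrow> 'a \<Rightarrow> 'o \<Rightarrow> 'a set \<Rightarrow>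
   ('a \<Rightarrow> 'o set) \<Rightarrow> bool" where
  "trading C r own i a S own' \<longleftrightarrow>
     (\<exists>p k x.
        length p = Suc k \<and> 1 \<le> k \<and> distinct p \<and> p ! 0 = i \<and>
        (\<forall>s<k. (p ! s, p ! Suc s) \<in> TG C own i {a} S) \<and>
        (\<forall>s<k. \<not> labelled own (p ! s)) \<and> labelled own (p ! k) \<and>
        x = highest r (own (p ! k) \<inter> targets C own i {a} (p ! (k - 1))) \<and>
        (\<forall>s<k - 1. own' (p ! s) = own (p ! Suc s)) \<and>
        own' (p ! (k - 1)) = {x} \<and>
        own' (p ! k) = own (p ! k) - {x} \<and>
        (\<forall>j. j \<notin> set p \<longrightarrow> own' j = own j))"


section \<open>SDMT-2\<close>

definition unallocated :: "'o set \<Rightarrow> ('a \<Rightarrow> 'o set) \<Rightarrow> 'o set" where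
  "unallocated Ob own = Ob - (\<Union>j. own j)"

definition first_free_class ::
  "'o set \<Rightarrow> ('a, 'o) preferences \<Rightarrow> ('a \<Rightarrow> 'o set) \<Rightarrow> 'a \<Rightarrow> nat" where
  "first_free_class Ob C own i =
     (if \<exists>j\<ge>1. unallocated Ob own \<inter> C i j \<noteq> {}
      then LEAST j. 1 \<le> j \<and> unallocated Ob own \<inter> C i j \<noteq> {}
      else card Ob + 1)"

definition first_trading_class ::
  "'o set \<Rightarrow> ('a, 'o) preferences \<Rightarrow> ('o \<times> 'o) set \<Rightarrow> ('a \<Rightarrow> 'o set) \<Rightarrow> 'a \<Rightarrow> 'a set \<Rightarrow> nat" where
  "first_trading_class Ob C r own i S =
     (case max_TG C r own i S of None \<Rightarrow> card Ob + 1 | Some a \<Rightarrow> class_index C i a)"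

inductive sdmt2_agent ::
  "'o set \<Rightarrow> ('a, 'o) preferences \<Rightarrow> ('o \<times> 'o) set \<Rightarrow> 'a set \<Rightarrow> 'a \<Rightarrow>
   ('a \<Rightarrow> 'o set) \<Rightarrow> ('a \<Rightarrow> 'o set) \<Rightarrow> bool"
  for Ob :: "'o set" and C :: "('a, 'o) preferences" and r :: "('o \<times> 'o) set"
    and S :: "'a set" and i :: 'a and own :: "'a \<Rightarrow> 'o set" where
  allocate: "\<lbrakk>j1 = first_free_class Ob C own i; j1 \<le> first_trading_class Ob C r own i S\<rbrakk>
    \<Longrightarrow> sdmt2_agent Ob C r S i own (own(i := unallocated Ob own \<inter> C i j1))"
| trade: "\<lbrakk>first_trading_class Ob C r own i S < first_free_class Ob C own i;
     max_TG C r own i S = Some a; trading C r own i a S own'\<rbrakk>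
    \<Longrightarrow> sdmt2_agent Ob C r S i own own'"

text \<open>The argument \<open>S\<close> is the set of the agents processed so far.\<close>

inductive sdmt2_run ::
  "'o set \<Rightarrow> ('a, 'o) preferences \<Rightarrow> ('o \<times> 'o) set \<Rightarrow> 'a set \<Rightarrow> 'a list \<Rightarrow>
   ('a \<Rightarrow> 'o set) \<Rightarrow> ('a \<Rightarrow> 'o set) \<Rightarrow> bool"
  for Ob :: "'o set" and C :: "('a, 'o) preferences" and r :: "('o \<times> 'o) set" where
  finished: "sdmt2_run Ob C r S [] own own"
| process: "\<lbrakk>sdmt2_agent Ob C r S i own own'; sdmt2_run Ob C r (insert i S) \<sigma> own' own''\<rbrakk>
    \<Longrightarrow> sdmt2_run Ob C r S (i # \<sigma>) own own''"

definition final_matching :: "('o \<times> 'o) set \<Rightarrow> ('a \<Rightarrow> 'o set) \<Rightarrow> ('a \<times> 'o) set" where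
  "final_matching r own =
     {(j, x). (labelled own j \<and> x = highest r (own j)) \<or> (\<not> labelled own j \<and> own j = {x})}"

text \<open>\<open>\<mu>\<close> is a possible output of SDMT-2 for the order \<open>\<sigma>\<close> of the agents.\<close>

definition sdmt2 ::
  "'o set \<Rightarrow> ('a, 'o) preferences \<Rightarrow> ('o \<times> 'o) set \<Rightarrow> 'a list \<Rightarrow> ('a \<times> 'o) set \<Rightarrow> bool" where
  "sdmt2 Ob C r \<sigma> \<mu> \<longleftrightarrow>
     (\<exists>own. sdmt2_run Ob C r {} \<sigma> (\<lambda>_. {}) own \<and> \<mu> = final_matching r own)"


section \<open>Every input has an output\<close>

context house_allocation
begin

lemma sdmt1_agent_total:
  assumes "i \<in> N" "1 \<le> l"
  shows "\<exists>E' \<mu>'. sdmt1_agent C i l E \<mu> E' \<mu>'"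
  using assms(2)
proof (induction "card Ob + 1 - l" arbitrary: l)
  case 0
  then have "C i l = {}"
    using class_empty[OF assms(1), of "card Ob + 1" l] class_last[OF assms(1)] by simp
  then show ?case by (blast intro: sdmt1_agent.exhausted)
next
  case (Suc d)
  then have "\<exists>E' \<mu>'. sdmt1_agent C i (Suc l) E \<mu> E' \<mu>'" by simp
  then obtain E' \<mu>' where *: "sdmt1_agent C i (Suc l) E \<mu> E' \<mu>'" by blast
  show ?case
  proof (cases "C i l = {}")
    case True
    then show ?thesis by (blast intro: sdmt1_agent.exhausted)
  next
    case False
    show ?thesis
    proof (cases "\<exists>xs ys. augmenting_path (E \<union> {i} \<times> C i l) \<mu> i xs ys")
      case True
      then show ?thesis using sdmt1_agent.augment[of C i l "E \<union> {i} \<times> C i l" E \<mu>] False by blast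
    next
      case no_path: False
      show ?thesis using sdmt1_agent.next_class[OF False no_path *] by blast
    qed
  qed
qed

theorem sdmt1_total:
  assumes "set \<sigma> \<subseteq> N"
  shows "\<exists>\<mu>. sdmt1 C \<sigma> \<mu>"
proof -
  have "\<exists>E' \<mu>'. sdmt1_run C \<sigma> E \<mu> E' \<mu>'" for E \<mu>
    using assms
  proof (induction \<sigma> arbitrary: E \<mu>)
    case Nil
    then show ?case by (blast intro: sdmt1_run.finished)
  next
    case (Cons i \<sigma>)
    obtain E1 \<mu>1 where "sdmt1_agent C i 1 E \<mu> E1 \<mu>1"
      using sdmt1_agent_total[of i 1 E \<mu>] Cons.prems by auto
    moreover obtain E2 \<mu>2 where "sdmt1_run C \<sigma> E1 \<mu>1 E2 \<mu>2"
      using Cons.IH[of E1 \<mu>1] Cons.prems by auto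
    ultimately show ?case by (blast intro: sdmt1_run.process)
  qed
  then show ?thesis unfolding sdmt1_def by blast
qed

end

lemma highest_spec:
  assumes "strict_linear_order_on Ob r" "A \<subseteq> Ob" "finite A" "A \<noteq> {}"
  shows "highest r A \<in> A \<and> (\<forall>y\<in>A - {highest r A}. (highest r A, y) \<in> r)"
proof -
  have tr: "trans r" and ir: "irrefl r" and tot: "total_on Ob r"
    using assms(1) unfolding strict_linear_order_on_def by auto
  have "\<exists>x. x \<in> A \<and> (\<forall>y\<in>A - {x}. (x, y) \<in> r)"
    using assms(3,4,2)
  proof (induction A rule: finite_ne_induct)
    case (singleton x)
    then show ?case by simp
  next
    case (insert x F)
    then obtain m where m: "m \<in> F" "\<forall>y\<in>F - {m}. (m, y) \<in> r" by auto
    have "x \<noteq> m" using m insert by auto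
    then consider "(x, m) \<in> r" | "(m, x) \<in> r"
      using tot insert.prems m unfolding total_on_def by blast
    then show ?case
    proof cases
      case 1
      then have "\<forall>y\<in>insert x F - {x}. (x, y) \<in> r" using m transD[OF tr, of x m] by auto
      then show ?thesis by blast
    next
      case 2
      then have "\<forall>y\<in>insert x F - {m}. (m, y) \<in> r" using m by auto
      then show ?thesis using m by blast
    qed
  qed
  then have "\<exists>!x. x \<in> A \<and> (\<forall>y\<in>A - {x}. (x, y) \<in> r)"
  proof (rule ex_ex1I)
    fix x y
    assume "x \<in> A \<and> (\<forall>z\<in>A - {x}. (x, z) \<in> r)" "y \<in> A \<and> (\<forall>z\<in>A - {y}. (y, z) \<in> r)"
    then have "x \<noteq> y \<Longrightarrow> (x, y) \<in> r \<and> (y, x) \<in> r" by auto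
    then show "x = y" using transD[OF tr, of x y x] irreflD[OF ir, of x] by auto
  qed
  from theI'[OF this] show ?thesis unfolding highest_def .
qed

lemma simple_path_exists:
  assumes "(i, j) \<in> R\<^sup>*"
  shows "\<exists>p k. length p = Suc k \<and> distinct p \<and> p ! 0 = i \<and> p ! k = j \<and>
           (\<forall>s<k. (p ! s, p ! Suc s) \<in> R)"
  using assms
proof (induction rule: rtrancl_induct)
  case base
  have "length [i] = Suc 0 \<and> distinct [i] \<and> [i] ! 0 = i \<and> [i] ! 0 = i \<and>
           (\<forall>s<0. ([i] ! s, [i] ! Suc s) \<in> R)" by simp
  then show ?case by blast
next
  case (step y z)
  then obtain p k where p: "length p = Suc k" "distinct p" "p ! 0 = i" "p ! k = y"
    "\<forall>s<k. (p ! s, p ! Suc s) \<in> R" by blast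
  show ?case
  proof (cases "z \<in> set p")
    case True
    then obtain m where m: "m < Suc k" "p ! m = z" using p by (metis in_set_conv_nth)
    then have "length (take (Suc m) p) = Suc m \<and> distinct (take (Suc m) p) \<and>
        take (Suc m) p ! 0 = i \<and> take (Suc m) p ! m = z \<and>
        (\<forall>s<m. (take (Suc m) p ! s, take (Suc m) p ! Suc s) \<in> R)"
      using p by simp
    then show ?thesis by blast
  next
    case False
    have "((p @ [z]) ! s, (p @ [z]) ! Suc s) \<in> R" if "s < Suc k" for s
      using that p(1,4,5) step(2) by (cases "s = k") (simp_all add: nth_append)
    moreover have "length (p @ [z]) = Suc (Suc k)" "distinct (p @ [z])"
      "(p @ [z]) ! 0 = i" "(p @ [z]) ! Suc k = z"
      using p(1-3) False by (simp_all add: nth_append)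
    ultimately show ?thesis by blast
  qed
qed

lemma TG_source_unlabelled:
  assumes "(h, j) \<in> TG C own i B S" "\<not> labelled own i"
  shows "\<not> labelled own h"
  using assms by (cases rule: TG.cases) auto

lemma TG_target: "(h, j) \<in> TG C own i B S \<Longrightarrow> j \<in> S"
  by (cases rule: TG.cases) auto

lemma trading_exists:
  assumes "own i = {}" "(i, j) \<in> (TG C own i {a} S)\<^sup>*" "labelled own j"
  shows "\<exists>own'. trading C r own i a S own' \<and> (\<forall>h. h \<notin> insert i S \<longrightarrow> own' h = own h)"
proof -
  obtain p k where p: "length p = Suc k" "distinct p" "p ! 0 = i" "p ! k = j"
    "\<forall>s<k. (p ! s, p ! Suc s) \<in> TG C own i {a} S"
    using simple_path_exists[OF assms(2)] by blast
  have ui: "\<not> labelled own i" using assms(1) by (simp add: labelled_def)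
  then have k: "1 \<le> k" using p assms(3) by (cases k) auto
  have unl: "\<forall>s<k. \<not> labelled own (p ! s)"
    using p(5) TG_source_unlabelled[OF _ ui] by blast
  have sub: "set p \<subseteq> insert i S"
  proof
    fix h assume "h \<in> set p"
    then obtain s where s: "s < Suc k" "p ! s = h" using p by (metis in_set_conv_nth)
    show "h \<in> insert i S"
    proof (cases s)
      case 0
      then show ?thesis using s p(3) by simp
    next
      case (Suc t)
      then have "(p ! t, h) \<in> TG C own i {a} S" using s p(5) by auto
      then have "h \<in> S" by (rule TG_target)
      then show ?thesis by simp
    qed
  qed
  define x where "x = highest r (own (p ! k) \<inter> targets C own i {a} (p ! (k - 1)))"
  define f where "f s = (if s = k then own (p ! k) - {x} else if s = k - 1 then {x}
      else own (p ! Suc s))" for s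
  define own' where "own' h = (if h \<in> set p then f (THE s. s < Suc k \<and> p ! s = h) else own h)" for h
  have own'_nth: "own' (p ! s) = f s" if "s < Suc k" for s
  proof -
    have "(THE t. t < Suc k \<and> p ! t = p ! s) = s"
      using that p by (auto intro!: the_equality simp: nth_eq_iff_index_eq)
    then show ?thesis using that p by (simp add: own'_def)
  qed
  have out: "own' h = own h" if "h \<notin> set p" for h using that by (simp add: own'_def)
  have moved: "\<forall>s<k - 1. own' (p ! s) = own (p ! Suc s)"
    using own'_nth by (auto simp: f_def)
  have last: "own' (p ! (k - 1)) = {x}"
    using own'_nth[of "k - 1"] k by (cases k) (simp_all add: f_def)
  have giver: "own' (p ! k) = own (p ! k) - {x}"
    using own'_nth[of k] by (simp add: f_def)
  have lab: "labelled own (p ! k)" using p(4) assms(3) by simp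
  have "trading C r own i a S own'"
    unfolding trading_def
    apply (rule exI[of _ p], rule exI[of _ k], rule exI[of _ x])
    using p(1,2,3,5) k unl lab x_def moved last giver out by simp
  moreover have "\<forall>h. h \<notin> insert i S \<longrightarrow> own' h = own h"
    using sub out by blast
  ultimately show ?thesis by blast
qed

context house_allocation
begin

lemma sdmt2_agent_total:
  assumes "i \<in> N" "own i = {}" and r: "strict_linear_order_on Ob r"
  shows "\<exists>own'. sdmt2_agent Ob C r S i own own' \<and> (\<forall>h. h \<notin> insert i S \<longrightarrow> own' h = own h)"
proof (cases "first_free_class Ob C own i \<le> first_trading_class Ob C r own i S")
  case True
  then show ?thesis using sdmt2_agent.allocate[OF refl True] by fastforce
next
  case False
  have "first_free_class Ob C own i \<le> card Ob + 1"
  proof (cases "\<exists>j\<ge>1. unallocated Ob own \<inter> C i j \<noteq> {}")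
    case True
    let ?P = "\<lambda>j. 1 \<le> j \<and> unallocated Ob own \<inter> C i j \<noteq> {}"
    from True obtain j where j: "?P j" by auto
    then have "j \<le> card Ob + 1"
      using class_empty[OF assms(1), of "card Ob + 1" j] class_last[OF assms(1)] by fastforce
    moreover have "(LEAST j. ?P j) \<le> j" using j by (rule Least_le)
    ultimately show ?thesis using True unfolding first_free_class_def by simp
  next
    case False
    then show ?thesis unfolding first_free_class_def by (simp only: if_False)
  qed
  with False obtain a where a: "max_TG C r own i S = Some a"
    unfolding first_trading_class_def by (cases "max_TG C r own i S") auto
  let ?H = "tradable C own i S"
  let ?P = "\<lambda>l. 1 \<le> l \<and> ?H \<inter> C i l \<noteq> {}"
  have ne: "?H \<noteq> {}" using a by (auto simp: max_TG_def Let_def)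
  then have "\<exists>l. ?P l" by (auto simp: tradable_def acceptable_def)
  then have l: "?P (LEAST l. ?P l)" by (rule LeastI_ex)
  then have sub: "?H \<inter> C i (LEAST l. ?P l) \<subseteq> Ob" using class_subset[OF assms(1)] by blast
  have "a = highest r (?H \<inter> C i (LEAST l. ?P l))"
    using a ne by (auto simp: max_TG_def Let_def)
  then have "a \<in> ?H"
    using highest_spec[OF r sub finite_subset[OF sub finite_Ob]] l by blast
  then obtain j where "(i, j) \<in> (TG C own i {a} S)\<^sup>*" "labelled own j"
    by (auto simp: tradable_def)
  from trading_exists[where r = r and C = C, OF assms(2) this] obtain own' where
    "trading C r own i a S own'" "\<forall>h. h \<notin> insert i S \<longrightarrow> own' h = own h" by blast
  then show ?thesis using sdmt2_agent.trade[of Ob C r own i S a own'] False a by auto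
qed

theorem sdmt2_total:
  assumes "set \<sigma> \<subseteq> N" "distinct \<sigma>" and r: "strict_linear_order_on Ob r"
  shows "\<exists>\<mu>. sdmt2 Ob C r \<sigma> \<mu>"
proof -
  have "\<exists>own'. sdmt2_run Ob C r S \<sigma> own own'"
    if "set \<sigma> \<inter> S = {}" "\<forall>h. h \<notin> S \<longrightarrow> own h = {}" for S own
    using assms(1,2) that
  proof (induction \<sigma> arbitrary: S own)
    case Nil
    then show ?case by (blast intro: sdmt2_run.finished)
  next
    case (Cons i \<sigma>)
    obtain own1 where 1: "sdmt2_agent Ob C r S i own own1"
      "\<forall>h. h \<notin> insert i S \<longrightarrow> own1 h = own h"
      using sdmt2_agent_total[OF _ _ r, of i own S] Cons.prems by auto
    have "\<exists>own2. sdmt2_run Ob C r (insert i S) \<sigma> own1 own2"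
      by (rule Cons.IH) (use Cons.prems 1 in auto)
    with 1 show ?case by (blast intro: sdmt2_run.process)
  qed
  from this[of "{}" "\<lambda>_. {}"] show ?thesis unfolding sdmt2_def by auto
qed

end

end

theory Submission
  imports Defs
begin

text \<open>
  Both algorithms maintain a bipartite graph \<open>E\<close> in which every served agent is joined to exactly
  the objects of one of his indifference classes, and the next agent gets the first class that can
  be added to \<open>E\<close> such that all agents of \<open>E\<close> can still be matched simultaneously. For SDMT-1, the
  graph is explicit. For SDMT-2, all objects of \<open>E\<close> are allocated, so any choice of an owned object
  for each agent matches all of them. In both cases, if the algorithm rejects a class, then the set
  of agents reachable from the new agent (by alternating paths, respectively in the trading graphs)
  has fewer neighbours than members, and hence the class cannot be added by Hall's condition.
  So \<open>E\<close> depends only on the input and the order of the agents.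
\<close>

section \<open>The greedy choice of classes\<close>

text \<open>A matching of all agents that have an edge, encoded as an injective choice of
  neighbours. Agents without edges impose no condition, so those left unmatched can simply be absent
  from \<open>E\<close>.\<close>

definition saturable :: "('a \<times> 'o) set \<Rightarrow> bool" where
  "saturable E \<longleftrightarrow> (\<exists>f. inj_on f (Domain E) \<and> (\<forall>j\<in>Domain E. (j, f j) \<in> E))"

text \<open>The easy half of Hall's theorem: composing a saturating choice with \<open>owner\<close>
  would inject \<open>X\<close> into \<open>X - {i}\<close>. A map \<open>owner\<close> stands in
  for a comparison of cardinalities because both algorithms supply one: the matched partner for
  SDMT-1, the owning agent for SDMT-2.\<close>

lemma not_saturable:
  assumes "finite X" "X \<subseteq> Domain E" "i \<in> X"
    and inj: "inj_on owner (E `` X)" and owner: "owner ` (E `` X) \<subseteq> X - {i}"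
  shows "\<not> saturable E"
proof
  assume "saturable E"
  then obtain f where f: "inj_on f (Domain E)" "\<forall>j\<in>Domain E. (j, f j) \<in> E"
    unfolding saturable_def by blast
  have sub: "f ` X \<subseteq> E `` X" using f(2) assms(2) by blast
  have "inj_on (owner \<circ> f) X"
    using inj_on_subset[OF f(1) assms(2)] inj_on_subset[OF inj sub] by (rule comp_inj_on)
  moreover have "(owner \<circ> f) ` X \<subseteq> X - {i}" using sub owner by (auto simp: image_comp[symmetric])
  ultimately have "card X \<le> card (X - {i})"
    using assms(1) by (intro card_inj_on_le[of "owner \<circ> f"]) auto
  then show False using assms(1,3) by (metis card_Diff1_less not_le)
qed

text \<open>Only the graph enters, neither a matching nor an allocation, so choices of paths and
  tie-breaking cannot influence the result. An empty class would leave \<open>E\<close> unchanged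
  and pass the saturability test vacuously.\<close>

definition serial_step ::
  "('a, 'o) preferences \<Rightarrow> 'a \<Rightarrow> ('a \<times> 'o) set \<Rightarrow> ('a \<times> 'o) set" where
  "serial_step C i E =
     (let P = \<lambda>l. 1 \<le> l \<and> C i l \<noteq> {} \<and> saturable (E \<union> {i} \<times> C i l) in
      if \<exists>l. P l then E \<union> {i} \<times> C i (LEAST l. P l) else E)"

lemma serial_step_eq:
  assumes "1 \<le> l" "C i l \<noteq> {}" "saturable (E \<union> {i} \<times> C i l)"
    and "\<And>m. 1 \<le> m \<Longrightarrow> m < l \<Longrightarrow> C i m \<noteq> {} \<Longrightarrow> \<not> saturable (E \<union> {i} \<times> C i m)"
  shows "serial_step C i E = E \<union> {i} \<times> C i l"
proof -
  let ?P = "\<lambda>l. 1 \<le> l \<and> C i l \<noteq> {} \<and> saturable (E \<union> {i} \<times> C i l)"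
  have "(LEAST l. ?P l) = l"
    using assms by (intro Least_equality) (auto simp: not_less[symmetric])
  moreover have "\<exists>l. ?P l" using assms by blast
  ultimately show ?thesis unfolding serial_step_def Let_def by simp
qed

lemma serial_step_none:
  assumes "\<And>m. 1 \<le> m \<Longrightarrow> C i m \<noteq> {} \<Longrightarrow> \<not> saturable (E \<union> {i} \<times> C i m)"
  shows "serial_step C i E = E"
proof -
  have "\<not> (\<exists>l. 1 \<le> l \<and> C i l \<noteq> {} \<and> saturable (E \<union> {i} \<times> C i l))" using assms by blast
  then show ?thesis unfolding serial_step_def Let_def by (simp only: if_False)
qed

lemma Domain_serial_step: "Domain (serial_step C i E) \<subseteq> insert i (Domain E)"
  unfolding serial_step_def Let_def by auto

section \<open>SDMT-1\<close>

text \<open>Invariant of SDMT-1. An agent whose classes were all rejected has lost his tentative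
  edges, so equality of the domains demands a partner exactly for the agents that were
  accepted.\<close>

definition matches_all :: "('a \<times> 'o) set \<Rightarrow> ('a \<times> 'o) set \<Rightarrow> bool" where
  "matches_all E \<mu> \<longleftrightarrow>
     \<mu> \<subseteq> E \<and> Domain \<mu> = Domain E \<and> single_valued \<mu> \<and> single_valued (\<mu>\<inverse>)"

section \<open>Saturating matchings and augmenting paths\<close>

lemma matches_all_saturable:
  assumes "matches_all E \<mu>"
  shows "saturable E"
proof -
  have "\<forall>j\<in>Domain E. \<exists>x. (j, x) \<in> \<mu>" using assms unfolding matches_all_def by blast
  then obtain f where f: "\<forall>j\<in>Domain E. (j, f j) \<in> \<mu>" by metis
  then have "inj_on f (Domain E)"
    using assms unfolding matches_all_def single_valued_def inj_on_def by (metis converse_iff)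
  then show ?thesis using f assms unfolding saturable_def matches_all_def by blast
qed

text \<open>The removed edges \<open>?D\<close> cover all agents of the path except \<open>i\<close>
  and all its objects except the last. Since these two ends are unmatched in \<open>\<mu>\<close>,
  everything touched by the added edges \<open>?A\<close> is free, and every agent who loses an edge
  gets a new one.\<close>

lemma matches_all_augment:
  assumes m: "matches_all E \<mu>" and i: "i \<notin> Domain E" and B: "B \<noteq> {}"
    and ap: "augmenting_path (E \<union> {i} \<times> B) \<mu> i xs ys"
  shows "matches_all (E \<union> {i} \<times> B) (sym_diff \<mu> (path_edges xs ys))"
proof -
  have sv: "single_valued \<mu>" "single_valued (\<mu>\<inverse>)" "\<mu> \<subseteq> E" "Domain \<mu> = Domain E"
    using m unfolding matches_all_def by auto
  let ?A = "set (zip xs ys)" and ?D = "set (zip (tl xs) ys)"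
  have p: "xs \<noteq> []" "length xs = length ys" "distinct xs" "distinct ys"
      "?A \<union> ?D \<subseteq> E \<union> {i} \<times> B" "?A \<inter> \<mu> = {}" "?D \<subseteq> \<mu>" "hd xs = i" "last ys \<notin> Range \<mu>"
    using ap unfolding augmenting_path_def path_edges_def by auto
  have new: "sym_diff \<mu> (path_edges xs ys) = \<mu> - ?D \<union> ?A"
    using p(6,7) unfolding path_edges_def by auto
  have agents: "Domain ?A = set xs"
  proof -
    have "fst ` ?A = set xs" using p(2) by (metis map_fst_zip list.set_map)
    then show ?thesis by (simp add: fst_eq_Domain)
  qed
  have D_agents: "set xs \<subseteq> insert i (Domain ?D)"
  proof -
    have "map fst (zip (tl xs) ys) = tl xs" using p(2) by (simp add: map_fst_zip_take)
    then have "Domain ?D = set (tl xs)" by (metis fst_eq_Domain list.set_map)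
    then show ?thesis using p(1,8) by (cases xs) auto
  qed
  have D_objects: "set ys \<subseteq> insert (last ys) (Range ?D)"
  proof -
    \<comment> \<open>\<open>zip\<close> stops at the shorter list \<open>tl xs\<close>, which drops
      exactly the last object.\<close>
    have "map snd (zip (tl xs) ys) = butlast ys"
      using p(2) by (simp add: map_snd_zip_take butlast_conv_take)
    then have "Range ?D = set (butlast ys)" by (metis snd_eq_Range list.set_map)
    moreover have "ys = butlast ys @ [last ys]" using p(1,2) by (cases ys) auto
    then have "set ys = insert (last ys) (set (butlast ys))"
      by (metis rotate1.simps(2) set_rotate1 list.simps(15))
    ultimately show ?thesis by simp
  qed
  have A_fun: "x = y" if "(a, x) \<in> ?A" "(a, y) \<in> ?A" for a x y
    using that p(3) by (auto simp: in_set_zip nth_eq_iff_index_eq)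
  have A_inj: "a = b" if "(a, x) \<in> ?A" "(b, x) \<in> ?A" for a b x
    using that p(4) by (auto simp: in_set_zip nth_eq_iff_index_eq)
  have mixed_agent: False if "(a, x) \<in> \<mu> - ?D" "(a, y) \<in> ?A" for a x y
  proof -
    have "a \<in> set xs" using that agents by blast
    moreover have "a \<noteq> i" using that i sv(3) by blast
    ultimately obtain z where z: "(a, z) \<in> ?D" using D_agents by blast
    then have "z = x" using that p(7) sv(1) unfolding single_valued_def by blast
    then show False using z that by blast
  qed
  have mixed_object: False if "(a, x) \<in> \<mu> - ?D" "(b, x) \<in> ?A" for a b x
  proof -
    have "x \<in> set ys" using that by (auto dest: set_zip_rightD)
    moreover have "x \<noteq> last ys" using that p(9) by blast
    ultimately obtain c where c: "(c, x) \<in> ?D" using D_objects by blast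
    then have "c = a" using that p(7) sv(2) unfolding single_valued_def by blast
    then show False using c that by blast
  qed
  have "single_valued (\<mu> - ?D \<union> ?A)"
    unfolding single_valued_def using mixed_agent A_fun sv(1)[unfolded single_valued_def]
    by blast
  moreover have "single_valued ((\<mu> - ?D \<union> ?A)\<inverse>)"
    unfolding single_valued_def using mixed_object A_inj sv(2)[unfolded single_valued_def]
    by blast
  moreover have "\<mu> - ?D \<union> ?A \<subseteq> E \<union> {i} \<times> B" using sv(3) p(5) by blast
  moreover have "Domain (\<mu> - ?D \<union> ?A) = Domain (E \<union> {i} \<times> B)"
  proof
    show "Domain (\<mu> - ?D \<union> ?A) \<subseteq> Domain (E \<union> {i} \<times> B)" using sv(3) p(5) by blast
    have "Domain ?D \<subseteq> set xs" by (auto dest: set_zip_leftD intro: list.set_sel(2)[OF p(1)])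
    moreover have "i \<in> set xs" using p(1,8) by auto
    ultimately show "Domain (E \<union> {i} \<times> B) \<subseteq> Domain (\<mu> - ?D \<union> ?A)"
      using sv(4) agents by blast
  qed
  ultimately show ?thesis unfolding matches_all_def new by blast
qed

text \<open>If no agent reachable from \<open>i\<close> by alternating steps had an unmatched
  neighbour, then all neighbours of the reachable set would have partners in it other than
  \<open>i\<close>, contradicting \<open>not_saturable\<close>. So some reachable agent has an
  unmatched neighbour, and a simple path to him, extended by that object, augments.\<close>

lemma saturable_augmenting_path:
  assumes m: "matches_all E \<mu>" and fin: "finite (Domain E)" and i: "i \<notin> Domain E"
    and sat: "saturable (E \<union> {i} \<times> B)" and B: "B \<noteq> {}"
  shows "\<exists>xs ys. augmenting_path (E \<union> {i} \<times> B) \<mu> i xs ys"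
proof -
  have sv: "single_valued \<mu>" "single_valued (\<mu>\<inverse>)" "\<mu> \<subseteq> E" "Domain \<mu> = Domain E"
    using m unfolding matches_all_def by auto
  let ?F = "E \<union> {i} \<times> B"
  \<comment> \<open>One step of \<open>R\<close> is two edges of an alternating path: out along an
    edge outside \<open>\<mu>\<close>, back along an edge of \<open>\<mu>\<close>.\<close>
  define R where "R = {(a, b). \<exists>x. (a, x) \<in> ?F - \<mu> \<and> (b, x) \<in> \<mu>}"
  define X where "X = R\<^sup>* `` {i}"
  have X: "X \<subseteq> insert i (Domain E)"
  proof
    fix b assume "b \<in> X"
    then have "b = i \<or> (\<exists>a. (a, b) \<in> R)" unfolding X_def by (auto elim: rtranclE)
    then show "b \<in> insert i (Domain E)" using sv(4) unfolding R_def by blast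
  qed
  have owner: "\<exists>b\<in>X - {i}. (b, x) \<in> \<mu>" if "a \<in> X" "(a, x) \<in> ?F" "x \<in> Range \<mu>" for a x
  proof -
    from that(3) obtain b where b: "(b, x) \<in> \<mu>" by blast
    then have "b \<noteq> i" using i sv(3) by blast
    moreover have "b \<in> X"
    proof (cases "(a, x) \<in> \<mu>")
      case True
      then have "a = b" using b sv(2) unfolding single_valued_def by blast
      then show ?thesis using that by simp
    next
      case False
      then have "(a, b) \<in> R" using that b unfolding R_def by blast
      then show ?thesis using that(1) unfolding X_def by (auto intro: rtrancl_into_rtrancl)
    qed
    ultimately show ?thesis using b by blast
  qed
  have "\<exists>a\<in>X. \<exists>x. (a, x) \<in> ?F \<and> x \<notin> Range \<mu>"
  proof (rule ccontr)
    assume "\<not> ?thesis"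
    then have "\<forall>x\<in>?F `` X. \<exists>b. b \<in> X - {i} \<and> (b, x) \<in> \<mu>" using owner by blast
    then obtain f where f: "\<forall>x\<in>?F `` X. f x \<in> X - {i} \<and> (f x, x) \<in> \<mu>" by metis
    have "inj_on f (?F `` X)"
    proof (rule inj_onI)
      fix x y assume "x \<in> ?F `` X" "y \<in> ?F `` X" "f x = f y"
      then have "(f x, x) \<in> \<mu>" "(f x, y) \<in> \<mu>" using f by (blast, metis)
      then show "x = y" using sv(1) unfolding single_valued_def by blast
    qed
    moreover have "f ` (?F `` X) \<subseteq> X - {i}" using f by blast
    moreover have "finite X" using X fin by (meson finite.insertI finite_subset)
    moreover have "X \<subseteq> Domain ?F" using X B by blast
    moreover have "i \<in> X" unfolding X_def by blast
    ultimately have "\<not> saturable ?F" by (intro not_saturable)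
    then show False using sat by simp
  qed
  then obtain a x where ax: "(i, a) \<in> R\<^sup>*" "(a, x) \<in> ?F" "x \<notin> Range \<mu>"
    unfolding X_def by blast
  obtain p k where p: "length p = Suc k" "distinct p" "p ! 0 = i" "p ! k = a"
    "\<forall>s<k. (p ! s, p ! Suc s) \<in> R"
    using simple_path_exists[OF ax(1)] by blast
  have "\<forall>s. \<exists>y. s < k \<longrightarrow> (p ! s, y) \<in> ?F - \<mu> \<and> (p ! Suc s, y) \<in> \<mu>"
    using p(5) unfolding R_def by blast
  then obtain g where g: "\<And>s. s < k \<Longrightarrow> (p ! s, g s) \<in> ?F - \<mu> \<and> (p ! Suc s, g s) \<in> \<mu>"
    by metis
  \<comment> \<open>\<open>g s\<close> links \<open>p ! s\<close> to its successor for
    \<open>s < k\<close>; index \<open>k\<close>, which has no successor, gets the unmatched object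
    \<open>x\<close>.\<close>
  define h where "h = g(k := x)"
  define ys where "ys = map h [0..<Suc k]"
  have fwd: "(p ! s, h s) \<in> ?F - \<mu>" if "s < Suc k" for s
    using that g ax p(4) by (cases "s = k") (auto simp: h_def)
  have bwd: "(p ! Suc s, h s) \<in> \<mu>" if "s < k" for s
    using that g by (auto simp: h_def)
  \<comment> \<open>Below \<open>k\<close>, the object \<open>h s\<close> has partner
    \<open>p ! Suc s\<close> in \<open>\<mu>\<close>, and \<open>p\<close> is distinct;
    \<open>h k\<close> has no partner at all.\<close>
  have h_inj: "inj_on h {0..<Suc k}"
  proof (rule inj_onI)
    fix s t assume st: "s \<in> {0..<Suc k}" "t \<in> {0..<Suc k}" "h s = h t"
    have hk: "h u \<noteq> h k" if "u < k" for u using bwd[OF that] ax(3) by (auto simp: h_def)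
    show "s = t"
    proof (cases "s < k \<and> t < k")
      case True
      then have "p ! Suc s = p ! Suc t"
        using bwd[of s] bwd[of t] st(3) sv(2) unfolding single_valued_def by auto
      then show ?thesis using True p(1,2) by (simp add: nth_eq_iff_index_eq)
    next
      case False
      then show ?thesis using st hk[of s] hk[of t] by (cases "s = k"; cases "t = k") auto
    qed
  qed
  have A: "set (zip p ys) \<subseteq> ?F - \<mu>"
  proof
    fix z assume "z \<in> set (zip p ys)"
    then obtain s where "s < Suc k" "z = (p ! s, h s)"
      using p(1) unfolding ys_def by (auto simp: in_set_zip simp del: upt_Suc)
    then show "z \<in> ?F - \<mu>" using fwd by blast
  qed
  have D: "set (zip (tl p) ys) \<subseteq> \<mu>"
    using bwd p(1) unfolding ys_def by (auto simp: in_set_zip nth_tl simp del: upt_Suc)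
  have "augmenting_path ?F \<mu> i p ys"
    unfolding augmenting_path_def path_edges_def
  proof (intro conjI)
    show "p \<noteq> []" "distinct p" using p by auto
    show "length p = length ys" using p(1) unfolding ys_def by simp
    show "distinct ys" unfolding ys_def using h_inj by (simp add: distinct_map del: upt_Suc)
    show "hd p = i" using p(1,3) by (cases p) auto
    show "last ys \<notin> Range \<mu>" using ax(3) unfolding ys_def h_def by simp
    show "set (zip p ys) \<union> set (zip (tl p) ys) \<subseteq> ?F" using A D sv(3) by blast
  qed (use A D in auto)
  then show ?thesis by blast
qed

section \<open>One round and a full run of SDMT-1\<close>

context house_allocation
begin

text \<open>The last assumption carries the rejections made so far through the loop over
  \<open>l\<close>. An augmenting path yields a saturating matching, and by
  \<open>saturable_augmenting_path\<close> its absence rules one out, so the loop stops at the least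
  admissible class.\<close>

lemma sdmt1_agent_serial_step:
  assumes "sdmt1_agent C i l E \<mu> E' \<mu>'" "i \<in> N" "i \<notin> Domain E" "finite (Domain E)"
    and "matches_all E \<mu>" "1 \<le> l"
    and "\<And>m. 1 \<le> m \<Longrightarrow> m < l \<Longrightarrow> C i m \<noteq> {} \<Longrightarrow> \<not> saturable (E \<union> {i} \<times> C i m)"
  shows "E' = serial_step C i E \<and> matches_all E' \<mu>'"
  using assms
proof (induction rule: sdmt1_agent.induct)
  case (exhausted l E \<mu>)
  \<comment> \<open>Classes are empty from \<open>l\<close> onwards, so a nonempty one has an index
    below \<open>l\<close> and was rejected earlier.\<close>
  have "\<not> saturable (E \<union> {i} \<times> C i m)" if "1 \<le> m" "C i m \<noteq> {}" for m
    using that exhausted.prems(5,6) class_empty[OF exhausted.prems(1) _ _ exhausted.hyps, of m]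
    by (cases "m < l") auto
  then show ?case using serial_step_none[of C i E] exhausted.prems(4) by simp
next
  case (augment l E' E \<mu> xs ys)
  have "matches_all E' (sym_diff \<mu> (path_edges xs ys))"
    using matches_all_augment[OF augment.prems(4,2) augment.hyps(1)] augment.hyps(2,3) by blast
  moreover from this have "saturable E'" by (rule matches_all_saturable)
  then have "serial_step C i E = E \<union> {i} \<times> C i l"
    using augment.hyps(2) by (intro serial_step_eq augment.prems(5,6) augment.hyps(1)) simp
  ultimately show ?case using augment.hyps(2) by simp
next
  case (next_class l E \<mu> E' \<mu>')
  have "\<not> saturable (E \<union> {i} \<times> C i l)"
    using saturable_augmenting_path[OF next_class.prems(4,3,2) _ next_class.hyps(1)]
      next_class.hyps(2) by blast
  then have "\<not> saturable (E \<union> {i} \<times> C i m)" if "1 \<le> m" "m < Suc l" "C i m \<noteq> {}" for m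
    using that next_class.prems(6) by (cases "m = l") auto
  then show ?case using next_class.IH next_class.prems(1-4) by auto
qed

text \<open>The final graph is a function of the input and \<open>\<sigma>\<close>; only
  \<open>\<mu>'\<close> can depend on the paths chosen.\<close>

lemma sdmt1_run_fold:
  assumes "sdmt1_run C \<sigma> E \<mu> E' \<mu>'" "set \<sigma> \<subseteq> N" "distinct \<sigma>" "set \<sigma> \<inter> Domain E = {}"
    and "finite (Domain E)" "matches_all E \<mu>"
  shows "E' = fold (serial_step C) \<sigma> E \<and> matches_all E' \<mu>'"
  using assms
proof (induction rule: sdmt1_run.induct)
  case (finished E \<mu>)
  then show ?case by simp
next
  case (process i E \<mu> E' \<mu>' \<sigma> E'' \<mu>'')
  have step: "E' = serial_step C i E" "matches_all E' \<mu>'"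
    using sdmt1_agent_serial_step[OF process.hyps(1)] process.prems by auto
  have dom: "Domain E' \<subseteq> insert i (Domain E)"
    unfolding step by (rule Domain_serial_step)
  then have "finite (Domain E')" using process.prems(4) by (meson finite.insertI finite_subset)
  moreover have "set \<sigma> \<inter> Domain E' = {}"
    using dom process.prems(2,3) by (simp add: disjoint_iff) blast
  ultimately show ?case using process.IH process.prems step by auto
qed

end

section \<open>SDMT-2\<close>

text \<open>Invariant of SDMT-2. The graph \<open>E\<close> is a ghost variable: it fixes the class
  from which each agent is served, also while objects change hands. The last conjunct, that every
  object of \<open>E\<close> has an owner, supplies the \<open>owner\<close> map for Hall's
  argument.\<close>

definition allocates ::
  "('a, 'o) preferences \<Rightarrow> ('a \<times> 'o) set \<Rightarrow> ('a \<Rightarrow> 'o set) \<Rightarrow> bool" where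
  "allocates C E own \<longleftrightarrow>
     (\<forall>j\<in>Domain E. \<exists>k\<ge>1. E `` {j} = C j k) \<and>
     (\<forall>j. own j \<subseteq> E `` {j}) \<and> (\<forall>j\<in>Domain E. own j \<noteq> {}) \<and>
     (\<forall>j m. own j \<inter> own m \<noteq> {} \<longrightarrow> j = m) \<and> Range E \<subseteq> (\<Union>j. own j)"

lemma allocates_saturable:
  assumes "allocates C E own"
  shows "saturable E"
proof -
  have "\<forall>j\<in>Domain E. \<exists>x. x \<in> own j" using assms unfolding allocates_def by blast
  then obtain f where f: "\<forall>j\<in>Domain E. f j \<in> own j" by metis
  then have "inj_on f (Domain E)"
    using assms unfolding allocates_def inj_on_def by (metis IntI empty_iff)
  moreover have "\<forall>j\<in>Domain E. (j, f j) \<in> E" using f assms unfolding allocates_def by blast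
  ultimately show ?thesis unfolding saturable_def by blast
qed

lemma TG_owns_target: "(h, j) \<in> TG C own i B S \<Longrightarrow> own j \<inter> targets C own i B h \<noteq> {}"
  by (cases rule: TG.cases) auto

lemma card_le_one_eq:
  assumes "finite A" "\<not> card A > 1" "x \<in> A" "y \<in> A"
  shows "x = y"
  using assms card_le_Suc0_iff_eq[of A] by auto

section \<open>Untradable classes violate Hall's condition\<close>

context house_allocation
begin

lemma finite_Image_allocates:
  assumes "allocates C E own" "Domain E \<subseteq> N"
  shows "finite (E `` {j})"
proof (cases "j \<in> Domain E")
  case True
  then obtain k where "1 \<le> k" "E `` {j} = C j k" using assms unfolding allocates_def by blast
  then show ?thesis using class_subset[of j k] True assms(2) finite_Ob finite_subset
    by (metis subsetD)
next
  case False
  then have "E `` {j} = {}" by blast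
  then show ?thesis by simp
qed

lemma finite_own:
  assumes "allocates C E own" "Domain E \<subseteq> N"
  shows "finite (own j)"
proof (rule finite_subset)
  show "own j \<subseteq> E `` {j}" using assms(1) unfolding allocates_def by simp
qed (rule finite_Image_allocates[OF assms])

text \<open>Let \<open>X\<close> consist of \<open>i\<close> and all agents reachable from
  \<open>i\<close> in the trading graphs of objects of class \<open>l\<close>. Untradability leaves
  no labelled agent in \<open>X\<close>, so each member owns at most one object. Every object
  adjacent to \<open>X\<close> is owned within \<open>X - {i}\<close>, and sending it to its owner
  is injective.\<close>

lemma not_saturable_untradable:
  assumes alloc: "allocates C E own" and S: "Domain E \<subseteq> S" "S \<subseteq> N"
    and i: "i \<notin> S" "i \<in> N" and l: "1 \<le> l" "C i l \<noteq> {}"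
    and free: "unallocated Ob own \<inter> C i l = {}" and untr: "tradable C own i S \<inter> C i l = {}"
  shows "\<not> saturable (E \<union> {i} \<times> C i l)"
proof -
  let ?F = "E \<union> {i} \<times> C i l"
  \<comment> \<open>\<open>tradable\<close> tests one object at a time, so the trading graphs of the
    single objects are kept apart and only their reachable sets are united.\<close>
  define X where "X = insert i (\<Union>a\<in>C i l. (TG C own i {a} S)\<^sup>* `` {i})"
  have own: "\<And>j. own j \<subseteq> E `` {j}" "\<And>j. j \<in> Domain E \<Longrightarrow> own j \<noteq> {}"
    "\<And>j m x. x \<in> own j \<Longrightarrow> x \<in> own m \<Longrightarrow> j = m" "Range E \<subseteq> (\<Union>j. own j)"
    "\<And>j. j \<in> Domain E \<Longrightarrow> \<exists>k\<ge>1. E `` {j} = C j k"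
    using alloc unfolding allocates_def by blast+
  have owner_S: "j \<in> S" if "x \<in> own j" for x j using that own(1) S(1) by blast
  have own_i: "own i = {}" using owner_S i(1) by blast
  have fin: "finite (own j)" for j using finite_own[OF alloc] S by blast
  \<comment> \<open>An agent reached other than \<open>i\<close> is pointed to, hence owns an object
    and has an edge in \<open>E\<close>. The incoming edge from \<open>h\<close> is what
    \<open>TG.onward\<close> asks for.\<close>
  have reach: "j \<in> Domain E \<and> (\<exists>h. (h, j) \<in> TG C own i {a} S)"
    if "(i, j) \<in> (TG C own i {a} S)\<^sup>*" "j \<noteq> i" for a j
  proof -
    from that obtain h where h: "(h, j) \<in> TG C own i {a} S" by (metis rtranclE)
    then have "own j \<noteq> {}" using TG_owns_target by fastforce
    then show ?thesis using own(1)[of j] h by blast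
  qed
  have X_sub: "X \<subseteq> insert i (Domain E)" unfolding X_def using reach by blast
  have unl: "\<not> labelled own j" if "j \<in> X" for j
  proof (cases "j = i")
    case True
    then show ?thesis using own_i unfolding labelled_def by simp
  next
    case False
    with that obtain a where a: "a \<in> C i l" "(i, j) \<in> (TG C own i {a} S)\<^sup>*"
      unfolding X_def by blast
    then have "a \<in> acceptable C i" using l(1) unfolding acceptable_def by auto
    then show ?thesis using a untr unfolding tradable_def by blast
  qed
  have closed: "\<exists>m. m \<in> X - {i} \<and> x \<in> own m" if j: "j \<in> X" "(j, x) \<in> ?F" for j x
  proof (cases "j = i")
    case True
    then have x: "x \<in> C i l" using j(2) S(1) i(1) by blast
    then have "x \<in> Ob" using class_subset[OF i(2) l(1)] by blast
    then obtain m where m: "x \<in> own m" using x free unfolding unallocated_def by blast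
    have "(i, m) \<in> TG C own i {x} S"
      by (rule TG.initial) (use m owner_S in \<open>auto simp: targets_def\<close>)
    then have "m \<in> X" using x unfolding X_def by blast
    then show ?thesis using m own_i by blast
  next
    case False
    then have jE: "(j, x) \<in> E" using j(2) by blast
    obtain a where a: "a \<in> C i l" "(i, j) \<in> (TG C own i {a} S)\<^sup>*"
      using j(1) False unfolding X_def by blast
    obtain h where h: "(h, j) \<in> TG C own i {a} S" using reach[OF a(2) False] by blast
    obtain m where m: "x \<in> own m" using jE own(4) by blast
    have "m \<in> X"
    \<comment> \<open>Either \<open>j\<close> owns \<open>x\<close> himself, or \<open>x\<close> is
      another object of his class and he, being unlabelled, points to its owner.\<close>
    proof (cases "m = j")
      case True
      then show ?thesis using j(1) by simp
    next
      case mj: False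
      obtain k where k: "1 \<le> k" "E `` {j} = C j k" using own(5) jE by blast
      have "own j \<inter> C j k \<noteq> {}" using own(1)[of j] own(2)[of j] jE k(2) by blast
      moreover have "x \<in> C j k" using jE k(2) by blast
      moreover have "x \<notin> own j" using own(3) m mj by blast
      ultimately have "x \<in> targets C own i {a} j"
        using False k(1) unfolding targets_def by auto
      then have "(j, m) \<in> TG C own i {a} S"
        using TG.onward[OF h unl[OF j(1)] owner_S[OF m]] m by blast
      then have "(i, m) \<in> (TG C own i {a} S)\<^sup>*" using a(2) by (rule rtrancl_into_rtrancl[rotated])
      then show ?thesis using a(1) unfolding X_def by blast
    qed
    then show ?thesis using m own_i by blast
  qed
  have "\<forall>x\<in>?F `` X. \<exists>m. m \<in> X - {i} \<and> x \<in> own m" using closed by blast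
  then obtain f where f: "\<forall>x\<in>?F `` X. f x \<in> X - {i} \<and> x \<in> own (f x)" by metis
  have "inj_on f (?F `` X)"
  proof (rule inj_onI)
    fix x y assume xy: "x \<in> ?F `` X" "y \<in> ?F `` X" "f x = f y"
    have "x \<in> own (f x)" "y \<in> own (f x)" "f x \<in> X" using f xy by (blast, metis, blast)
    then show "x = y"
      using card_le_one_eq[OF fin] unl unfolding labelled_def by blast
  qed
  moreover have "f ` (?F `` X) \<subseteq> X - {i}" using f by blast
  moreover have "finite X"
  proof (rule finite_subset)
    show "X \<subseteq> N" using X_sub S i(2) by blast
  qed (rule finite_N)
  moreover have "X \<subseteq> Domain ?F" using X_sub l(2) by blast
  moreover have "i \<in> X" unfolding X_def by blast
  ultimately show ?thesis by (intro not_saturable)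
qed

section \<open>Allocation and trading preserve the invariant\<close>

text \<open>The whole class enters the graph although \<open>i\<close> receives only its free part:
  the other objects of the class already have owners, so no object of the new graph is
  unowned.\<close>

lemma allocates_allocate:
  assumes alloc: "allocates C E own" and i: "i \<notin> Domain E" "i \<in> N" and l: "1 \<le> l"
    and free: "unallocated Ob own \<inter> C i l \<noteq> {}"
  shows "allocates C (E \<union> {i} \<times> C i l) (own(i := unallocated Ob own \<inter> C i l))"
proof -
  let ?U = "unallocated Ob own \<inter> C i l" and ?F = "E \<union> {i} \<times> C i l"
  let ?own = "own(i := ?U)"
  have own: "\<And>j. own j \<subseteq> E `` {j}" "\<And>j. j \<in> Domain E \<Longrightarrow> own j \<noteq> {}"
    "\<And>j m x. x \<in> own j \<Longrightarrow> x \<in> own m \<Longrightarrow> j = m" "Range E \<subseteq> (\<Union>j. own j)"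
    "\<And>j. j \<in> Domain E \<Longrightarrow> \<exists>k\<ge>1. E `` {j} = C j k"
    using alloc unfolding allocates_def by blast+
  have own_i: "own i = {}" using own(1)[of i] i(1) by blast
  have Fi: "?F `` {i} = C i l" using i(1) by blast
  have Fj: "?F `` {j} = E `` {j}" if "j \<noteq> i" for j using that by blast
  have U: "x \<notin> own j" if "x \<in> ?U" for x j using that unfolding unallocated_def by blast
  have "\<forall>j\<in>Domain ?F. \<exists>k\<ge>1. ?F `` {j} = C j k"
  proof
    fix j assume j: "j \<in> Domain ?F"
    show "\<exists>k\<ge>1. ?F `` {j} = C j k"
    proof (cases "j = i")
      case True
      show ?thesis unfolding True Fi using l by (intro exI[of _ l]) simp
    next
      case False
      then have "j \<in> Domain E" using j by blast
      then show ?thesis unfolding Fj[OF False] by (rule own(5))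
    qed
  qed
  moreover have "\<forall>j. ?own j \<subseteq> ?F `` {j}" using own(1) Fi Fj by auto
  moreover have "\<forall>j\<in>Domain ?F. ?own j \<noteq> {}" using own(2) free by auto
  moreover have "\<forall>j m. ?own j \<inter> ?own m \<noteq> {} \<longrightarrow> j = m"
    using own(3) U by (auto split: if_splits)
  moreover have "Range ?F \<subseteq> (\<Union>j. ?own j)"
  proof
    fix x assume "x \<in> Range ?F"
    then have "x \<in> Range E \<union> C i l" by blast
    moreover have "C i l \<subseteq> Ob" using class_subset[OF i(2) l] .
    ultimately have "x \<in> (\<Union>j. own j) \<or> x \<in> ?U" using own(4) unfolding unallocated_def by blast
    then show "x \<in> (\<Union>j. ?own j)" using own_i by (metis UN_iff UNIV_I empty_iff fun_upd_apply)
  qed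
  ultimately show ?thesis unfolding allocates_def by blast
qed

text \<open>Trading shifts objects along the path and leaves the set of owned objects unchanged.
  Each agent before the end receives an object of his \<open>targets\<close>, hence of his own class
  (of class \<open>l\<close> for \<open>i\<close>), and the labelled end can spare \<open>x\<close>.
  By \<open>free\<close>, class \<open>l\<close> was fully owned beforehand.\<close>

lemma allocates_trading:
  assumes alloc: "allocates C E own" and S: "Domain E \<subseteq> S" "S \<subseteq> N"
    and i: "i \<notin> S" "i \<in> N" and l: "1 \<le> l" "a \<in> C i l"
    and free: "unallocated Ob own \<inter> C i l = {}" and r: "strict_linear_order_on Ob r"
    and tr: "trading C r own i a S own'"
  shows "allocates C (E \<union> {i} \<times> C i l) own'"
proof -
  let ?F = "E \<union> {i} \<times> C i l"
  have own: "\<And>j. own j \<subseteq> E `` {j}" "\<And>j. j \<in> Domain E \<Longrightarrow> own j \<noteq> {}"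
    "\<And>j m x. x \<in> own j \<Longrightarrow> x \<in> own m \<Longrightarrow> j = m" "Range E \<subseteq> (\<Union>j. own j)"
    "\<And>j. j \<in> Domain E \<Longrightarrow> \<exists>k\<ge>1. E `` {j} = C j k"
    using alloc unfolding allocates_def by blast+
  have iE: "i \<notin> Domain E" using S(1) i(1) by blast
  have own_i: "own i = {}" using own(1)[of i] iE by blast
  have fin: "finite (own j)" for j using finite_own[OF alloc] S by blast
  have own_Ob: "own j \<subseteq> Ob" for j
  proof (cases "j \<in> Domain E")
    case True
    then obtain k where "1 \<le> k" "E `` {j} = C j k" using own(5) by blast
    then show ?thesis using own(1)[of j] class_subset[of j k] S True by blast
  next
    case False
    then show ?thesis using own(1)[of j] by blast
  qed
  obtain p k x where path: "length p = Suc k \<and> 1 \<le> k \<and> distinct p \<and> p ! 0 = i \<and>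
      (\<forall>s<k. (p ! s, p ! Suc s) \<in> TG C own i {a} S) \<and>
      (\<forall>s<k. \<not> labelled own (p ! s)) \<and> labelled own (p ! k) \<and>
      x = highest r (own (p ! k) \<inter> targets C own i {a} (p ! (k - 1))) \<and>
      (\<forall>s<k - 1. own' (p ! s) = own (p ! Suc s)) \<and>
      own' (p ! (k - 1)) = {x} \<and> own' (p ! k) = own (p ! k) - {x} \<and>
      (\<forall>j. j \<notin> set p \<longrightarrow> own' j = own j)"
    using tr unfolding trading_def by (elim exE)
  have p: "length p = Suc k" "1 \<le> k" "distinct p" "p ! 0 = i"
    and edge: "\<forall>s<k. (p ! s, p ! Suc s) \<in> TG C own i {a} S"
    and unl: "\<forall>s<k. \<not> labelled own (p ! s)" and lab: "labelled own (p ! k)"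
    and x: "x = highest r (own (p ! k) \<inter> targets C own i {a} (p ! (k - 1)))"
    and moved: "\<forall>s<k - 1. own' (p ! s) = own (p ! Suc s)"
    and last: "own' (p ! (k - 1)) = {x}" and giver: "own' (p ! k) = own (p ! k) - {x}"
    and out: "\<forall>j. j \<notin> set p \<longrightarrow> own' j = own j"
    using path by - (elim conjE, assumption)+
  \<comment> \<open>\<open>p ! n\<close> is the predecessor of the labelled end \<open>p ! k\<close>
    and the agent who receives \<open>x\<close>.\<close>
  obtain n where n: "k = Suc n" using p(2) by (cases k) auto
  have x_mem: "x \<in> own (p ! k) \<inter> targets C own i {a} (p ! n)"
  proof -
    let ?A = "own (p ! k) \<inter> targets C own i {a} (p ! n)"
    have "(p ! n, p ! k) \<in> TG C own i {a} S" using edge n by simp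
    then have ne: "?A \<noteq> {}" by (rule TG_owns_target)
    have sub: "?A \<subseteq> Ob" using own_Ob by blast
    have "finite ?A" using fin by blast
    then show ?thesis using highest_spec[OF r sub _ ne] x n by simp
  qed
  have idx: "p ! s = p ! t \<longleftrightarrow> s = t" if "s \<le> k" "t \<le> k" for s t
    using that p(1,3) by (simp add: nth_eq_iff_index_eq)
  have in_p: "(\<exists>s\<le>k. j = p ! s) \<longleftrightarrow> j \<in> set p" for j
    using p(1) by (auto simp: in_set_conv_nth less_Suc_eq_le)
  \<comment> \<open>The class found through \<open>targets\<close> is the one recorded in
    \<open>E\<close>: both contain an object owned by \<open>j\<close>, and classes are
    disjoint.\<close>
  have target_F: "targets C own i {a} j \<subseteq> ?F `` {j}" for j
  proof (cases "j = i")
    case True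
    then show ?thesis using l unfolding targets_def by auto
  next
    case False
    show ?thesis
    proof
      fix y assume "y \<in> targets C own i {a} j"
      then obtain q where q: "1 \<le> q" "own j \<inter> C j q \<noteq> {}" "y \<in> C j q"
        using False unfolding targets_def by auto
      then have jE: "j \<in> Domain E" using own(1)[of j] by blast
      then obtain q' where q': "1 \<le> q'" "E `` {j} = C j q'" using own(5) by blast
      have "C j q \<inter> C j q' \<noteq> {}" using q(2) q'(2) own(1)[of j] by blast
      then have "q = q'" using class_disjoint[OF _ q(1) q'(1)] jE S by blast
      then show "y \<in> ?F `` {j}" using q(3) q'(2) by blast
    qed
  qed
  have moved_ne: "own' (p ! s) \<noteq> {}" and moved_F: "own' (p ! s) \<subseteq> ?F `` {p ! s}"
    and moved_own: "own' (p ! s) \<subseteq> own (p ! Suc s)" if s: "s < k" for s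
  proof -
    have "own' (p ! s) \<noteq> {} \<and> own' (p ! s) \<subseteq> own (p ! Suc s) \<inter> targets C own i {a} (p ! s)"
    proof (cases "s = n")
      case True
      then show ?thesis using last n x_mem by auto
    next
      case False
      then have s': "s < k - 1" "Suc s < k" using s n by auto
      obtain y where y: "y \<in> own (p ! Suc s)" "y \<in> targets C own i {a} (p ! s)"
        using TG_owns_target[OF edge[rule_format, OF s]] by blast
      \<comment> \<open>The successor is unlabelled here, so the object that caused the edge is all
        he owns.\<close>
      have "own (p ! Suc s) = {y}"
        using card_le_one_eq[OF fin, of "p ! Suc s"] unl s'(2) y(1) unfolding labelled_def by blast
      then show ?thesis using moved s'(1) y by auto
    qed
    then show "own' (p ! s) \<noteq> {}" "own' (p ! s) \<subseteq> ?F `` {p ! s}" "own' (p ! s) \<subseteq> own (p ! Suc s)"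
      using target_F by blast+
  qed
  have giver_ne: "own' (p ! k) \<noteq> {}"
  proof
    assume "own' (p ! k) = {}"
    then have "own (p ! k) \<subseteq> {x}" using giver by blast
    then have "card (own (p ! k)) \<le> card {x}" by (intro card_mono) auto
    then show False using lab unfolding labelled_def by simp
  qed
  have cases: "j \<notin> set p \<or> (\<exists>s<k. j = p ! s) \<or> j = p ! k" for j
    using in_p[of j] by (metis le_eq_less_or_eq)
  \<comment> \<open>Traces an object back to its former owner. The clauses on \<open>x\<close>
    handle the end \<open>p ! k\<close>, whose objects are split: \<open>x\<close> goes to
    \<open>p ! n\<close>, the others stay.\<close>
  have source: "(j \<notin> set p \<and> y \<in> own j) \<or> (\<exists>s<k. j = p ! s \<and> y \<in> own (p ! Suc s) \<and> (s = n \<longrightarrow> y = x))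
      \<or> (j = p ! k \<and> y \<in> own (p ! k) \<and> y \<noteq> x)" if "y \<in> own' j" for y j
    using cases[of j] that out giver last moved_own n by fastforce
  have "\<forall>j\<in>Domain ?F. \<exists>k\<ge>1. ?F `` {j} = C j k"
  proof
    fix j assume j: "j \<in> Domain ?F"
    show "\<exists>k\<ge>1. ?F `` {j} = C j k"
    proof (cases "j = i")
      case True
      have "?F `` {i} = C i l" using iE by blast
      then show ?thesis unfolding True using l(1) by (intro exI[of _ l]) simp
    next
      case False
      then have eq: "?F `` {j} = E `` {j}" and "j \<in> Domain E" using j by blast+
      then show ?thesis unfolding eq by (intro own(5))
    qed
  qed
  moreover have "\<forall>j. own' j \<subseteq> ?F `` {j}"
  proof
    fix j
    show "own' j \<subseteq> ?F `` {j}" using cases[of j]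
    proof (elim disjE exE conjE)
      assume "j \<notin> set p" then show ?thesis using out own(1)[of j] by auto
    next
      fix s assume "s < k" "j = p ! s" then show ?thesis using moved_F by blast
    next
      assume "j = p ! k" then show ?thesis using giver own(1)[of j] by blast
    qed
  qed
  moreover have "\<forall>j\<in>Domain ?F. own' j \<noteq> {}"
  proof
    fix j assume j: "j \<in> Domain ?F"
    show "own' j \<noteq> {}" using cases[of j]
    proof (elim disjE exE conjE)
      assume np: "j \<notin> set p"
      then have "j \<noteq> i" using p(1,4) by (metis nth_mem zero_less_Suc)
      then show ?thesis using np out own(2)[of j] j by auto
    next
      fix s assume "s < k" "j = p ! s" then show ?thesis using moved_ne by blast
    next
      assume "j = p ! k" then show ?thesis using giver_ne by blast
    qed
  qed
  \<comment> \<open>Former owners are unique and the shift along \<open>p\<close> is injective; only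
    the objects of \<open>p ! k\<close> get two holders, and \<open>x\<close> separates
    these.\<close>
  moreover have "\<forall>j m. own' j \<inter> own' m \<noteq> {} \<longrightarrow> j = m"
  proof (intro allI impI)
    fix j m assume "own' j \<inter> own' m \<noteq> {}"
    then obtain y where y: "y \<in> own' j" "y \<in> own' m" by blast
    have mem: "p ! s \<in> set p" if "s \<le> k" for s using in_p that by blast
    show "j = m" using source[OF y(1)] source[OF y(2)]
    proof (elim disjE exE conjE)
      fix s t assume s: "s < k" "j = p ! s" "y \<in> own (p ! Suc s)"
        and t: "t < k" "m = p ! t" "y \<in> own (p ! Suc t)"
      then have "p ! Suc s = p ! Suc t" using own(3) by blast
      then show ?thesis using s t idx[of "Suc s" "Suc t"] by simp
    next
      fix s assume s: "s < k" "y \<in> own (p ! Suc s)" "s = n \<longrightarrow> y = x"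
        and t: "y \<in> own (p ! k)" "y \<noteq> x"
      then have "p ! Suc s = p ! k" using own(3) by blast
      then show ?thesis using s t idx[of "Suc s" k] n by simp
    next
      fix s assume s: "s < k" "y \<in> own (p ! Suc s)" "s = n \<longrightarrow> y = x"
        and t: "y \<in> own (p ! k)" "y \<noteq> x"
      then have "p ! Suc s = p ! k" using own(3) by blast
      then show ?thesis using s t idx[of "Suc s" k] n by simp
    next
      fix s assume s: "s < k" "y \<in> own (p ! Suc s)" and t: "j \<notin> set p" "y \<in> own j"
      then have "j = p ! Suc s" using own(3) by blast
      then show ?thesis using s t mem[of "Suc s"] by simp
    next
      fix s assume s: "s < k" "y \<in> own (p ! Suc s)" and t: "m \<notin> set p" "y \<in> own m"
      then have "m = p ! Suc s" using own(3) by blast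
      then show ?thesis using s t mem[of "Suc s"] by simp
    qed (use own(3) mem[of k] in \<open>blast+\<close>)
  qed
  moreover have "Range ?F \<subseteq> (\<Union>j. own' j)"
  proof
    fix y assume "y \<in> Range ?F"
    moreover have "C i l \<subseteq> (\<Union>j. own j)"
      using free class_subset[OF i(2) l(1)] unfolding unallocated_def by blast
    ultimately obtain j where j: "y \<in> own j" using own(4) by blast
    show "y \<in> (\<Union>j. own' j)" using cases[of j]
    proof (elim disjE exE conjE)
      assume "j \<notin> set p" then show ?thesis using out j by auto
    next
      fix s assume s: "s < k" "j = p ! s"
      \<comment> \<open>\<open>i\<close> owned nothing before, so \<open>s\<close> is positive and
        the predecessor now holds the object.\<close>
      then obtain t where t: "s = Suc t" using j p(4) own_i by (cases s) auto
      then have "own' (p ! t) = own (p ! Suc t)" using moved s by simp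
      then show ?thesis using t s j by blast
    next
      assume "j = p ! k" then show ?thesis using giver last j by (cases "y = x") auto
    qed
  qed
  ultimately show ?thesis unfolding allocates_def by blast
qed

section \<open>The class chosen by SDMT-2\<close>

text \<open>Replaces the \<open>LEAST\<close>, \<open>THE\<close> and \<open>highest\<close> of the
  definitions by what the later arguments use: the class in which \<open>max_TG\<close> lies, and
  that no earlier class is tradable.\<close>

lemma max_TG_cases:
  assumes "i \<in> N" and r: "strict_linear_order_on Ob r"
  obtains (none) "max_TG C r own i S = None" "tradable C own i S = {}"
  | (some) a k where "max_TG C r own i S = Some a" "1 \<le> k" "a \<in> C i k" "class_index C i a = k"
      "\<And>l. 1 \<le> l \<Longrightarrow> l < k \<Longrightarrow> tradable C own i S \<inter> C i l = {}"
proof (cases "tradable C own i S = {}")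
  case True
  then show ?thesis using none by (simp add: max_TG_def Let_def)
next
  case False
  let ?H = "tradable C own i S"
  let ?P = "\<lambda>l. 1 \<le> l \<and> ?H \<inter> C i l \<noteq> {}"
  let ?k = "LEAST l. ?P l" and ?a = "highest r (?H \<inter> C i (LEAST l. ?P l))"
  have "\<exists>l. ?P l" using False by (auto simp: tradable_def acceptable_def)
  then have k: "?P ?k" by (rule LeastI_ex)
  then have sub: "?H \<inter> C i ?k \<subseteq> Ob" using class_subset[OF assms(1)] by blast
  have a: "?a \<in> C i ?k"
    using highest_spec[OF r sub finite_subset[OF sub finite_Ob]] k by blast
  have "class_index C i ?a = ?k"
    unfolding class_index_def
  proof (rule the_equality)
    show "1 \<le> ?k \<and> ?a \<in> C i ?k" using k a by blast
    fix m assume "1 \<le> m \<and> ?a \<in> C i m"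
    then show "m = ?k" using a k class_disjoint[OF assms(1), of m ?k] by blast
  qed
  moreover have "?H \<inter> C i l = {}" if "1 \<le> l" "l < ?k" for l
    using not_less_Least[OF that(2)] that(1) by blast
  ultimately show ?thesis
    using some[of ?a ?k] k a False by (simp add: max_TG_def Let_def)
qed

lemma untradable_below:
  assumes "i \<in> N" and r: "strict_linear_order_on Ob r"
    and "1 \<le> l" "l < first_trading_class Ob C r own i S"
  shows "tradable C own i S \<inter> C i l = {}"
  using assms(1) r
proof (cases rule: max_TG_cases[where own = own and S = S])
  case none
  then show ?thesis by simp
next
  case (some a k)
  then show ?thesis using assms(3,4) by (simp add: first_trading_class_def)
qed

lemma no_free_below:
  assumes "i \<in> N" "1 \<le> l" "l < first_free_class Ob C own i"
  shows "unallocated Ob own \<inter> C i l = {}"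
proof (cases "\<exists>j\<ge>1. unallocated Ob own \<inter> C i j \<noteq> {}")
  case True
  then have "l < (LEAST j. 1 \<le> j \<and> unallocated Ob own \<inter> C i j \<noteq> {})"
    using assms(3) unfolding first_free_class_def by simp
  from not_less_Least[OF this] show ?thesis using assms(2) by blast
qed (use assms(2) in blast)

lemma first_free_class_cases:
  assumes "i \<in> N"
  obtains (free) "1 \<le> first_free_class Ob C own i"
      "unallocated Ob own \<inter> C i (first_free_class Ob C own i) \<noteq> {}"
  | (full) "first_free_class Ob C own i = card Ob + 1"
      "\<And>l. 1 \<le> l \<Longrightarrow> unallocated Ob own \<inter> C i l = {}"
proof (cases "\<exists>j\<ge>1. unallocated Ob own \<inter> C i j \<noteq> {}")
  case True
  let ?P = "\<lambda>j. 1 \<le> j \<and> unallocated Ob own \<inter> C i j \<noteq> {}"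
  have "\<exists>j. ?P j" using True by blast
  then have "?P (LEAST j. ?P j)" by (rule LeastI_ex)
  moreover have "first_free_class Ob C own i = (LEAST j. ?P j)"
    using True unfolding first_free_class_def by simp
  ultimately show ?thesis using free by simp
next
  case False
  then have "first_free_class Ob C own i = card Ob + 1"
    unfolding first_free_class_def by (simp only: if_False)
  then show ?thesis using full False by blast
qed

text \<open>Classes before both \<open>first_free_class\<close> and
  \<open>first_trading_class\<close> have neither a free nor a tradable object, so
  \<open>not_saturable_untradable\<close> rejects them. The class actually used is accepted because
  the new allocation saturates the new graph.\<close>

lemma sdmt2_agent_serial_step:
  assumes step: "sdmt2_agent Ob C r S i own own'" and r: "strict_linear_order_on Ob r"
    and alloc: "allocates C E own" and S: "Domain E \<subseteq> S" "S \<subseteq> N" and i: "i \<notin> S" "i \<in> N"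
  shows "allocates C (serial_step C i E) own'"
proof -
  have iE: "i \<notin> Domain E" using S i by blast
  have rejected: "\<not> saturable (E \<union> {i} \<times> C i m)"
    if "1 \<le> m" "m < first_free_class Ob C own i" "m < first_trading_class Ob C r own i S"
      "C i m \<noteq> {}" for m
    using that not_saturable_untradable[OF alloc S i] no_free_below[OF i(2)]
      untradable_below[OF i(2) r] by blast
  show ?thesis using step
  proof cases
    case (allocate j)
    show ?thesis using i(2)
    proof (cases rule: first_free_class_cases[where own = own])
      case free
      have new: "allocates C (E \<union> {i} \<times> C i j) own'"
        using allocates_allocate[OF alloc iE i(2)] free allocate by simp
      have "serial_step C i E = E \<union> {i} \<times> C i j"
        using rejected allocate free allocates_saturable[OF new]
        by (intro serial_step_eq) auto
      then show ?thesis using new by simp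
    next
      case full
      \<comment> \<open>The default index \<open>card Ob + 1\<close> points to an empty class:
        nothing is allocated, and every nonempty class lies below it.\<close>
      have "C i m = {}" if "j \<le> m" for m
        using class_empty[OF i(2), of j m] class_last[OF i(2)] full(1) allocate that by simp
      then have "serial_step C i E = E"
        using rejected allocate by (intro serial_step_none) (meson le_less_trans not_le less_le_trans)
      moreover have "own i = {}" using alloc iE unfolding allocates_def by blast
      then have "own' = own" using allocate class_last[OF i(2)] full(1) by (auto simp: fun_eq_iff)
      ultimately show ?thesis using alloc by simp
    qed
  next
    case (trade a)
    show ?thesis using i(2) r
    proof (cases rule: max_TG_cases[where own = own and S = S])
      case none
      then show ?thesis using trade by simp
    next
      case (some b k)
      have k: "first_trading_class Ob C r own i S = k" and ab: "b = a"
        using some trade unfolding first_trading_class_def by auto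
      have "unallocated Ob own \<inter> C i k = {}"
        using no_free_below[OF i(2)] some trade k by simp
      then have new: "allocates C (E \<union> {i} \<times> C i k) own'"
        using allocates_trading[OF alloc S i _ _ _ r] some trade ab by blast
      have "serial_step C i E = E \<union> {i} \<times> C i k"
        using rejected trade k some allocates_saturable[OF new]
        by (intro serial_step_eq) auto
      then show ?thesis using new by simp
    qed
  qed
qed

text \<open>\<open>S\<close> holds all processed agents, \<open>Domain E\<close> only those who were
  served, hence an inclusion between them rather than an equality.\<close>

lemma sdmt2_run_fold:
  assumes "sdmt2_run Ob C r S \<sigma> own own'" "strict_linear_order_on Ob r"
    and "allocates C E own" "Domain E \<subseteq> S" "S \<subseteq> N" "set \<sigma> \<subseteq> N" "distinct \<sigma>" "set \<sigma> \<inter> S = {}"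
  shows "allocates C (fold (serial_step C) \<sigma> E) own' \<and> Domain (fold (serial_step C) \<sigma> E) \<subseteq> N"
  using assms
proof (induction arbitrary: E rule: sdmt2_run.induct)
  case (finished S own)
  then show ?case by auto
next
  case (process S i own own' \<sigma> own'')
  have "allocates C (serial_step C i E) own'"
    using sdmt2_agent_serial_step[OF process.hyps(1)] process.prems by simp
  moreover have "Domain (serial_step C i E) \<subseteq> insert i S"
    using Domain_serial_step[of C i E] process.prems(3) by blast
  ultimately show ?case using process.IH[of "serial_step C i E"] process.prems by simp
qed

section \<open>Comparing the two outputs\<close>

text \<open>The tie-breaking order drops out here: whichever owned object \<open>r\<close> selects,
  it is a neighbour in \<open>E\<close>.\<close>

lemma final_matching_own:
  assumes "allocates C E own" "Domain E \<subseteq> N" "strict_linear_order_on Ob r"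
  shows "Domain (final_matching r own) = Domain E" "final_matching r own \<subseteq> E"
proof -
  have own: "\<And>j. own j \<subseteq> E `` {j}" "\<And>j. j \<in> Domain E \<Longrightarrow> own j \<noteq> {}"
    "\<And>j. j \<in> Domain E \<Longrightarrow> \<exists>k\<ge>1. E `` {j} = C j k"
    using assms(1) unfolding allocates_def by blast+
  have fin: "finite (own j)" for j using finite_own assms by blast
  have highest_own: "highest r (own j) \<in> own j" if "own j \<noteq> {}" for j
  proof -
    have "j \<in> Domain E" using that own(1) by blast
    then obtain k where "1 \<le> k" "E `` {j} = C j k" using own(3) by blast
    then have "own j \<subseteq> Ob"
      using own(1)[of j] class_subset[of j k] assms(2) \<open>j \<in> Domain E\<close> by blast
    then show ?thesis using highest_spec[OF assms(3) _ fin that] by blast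
  qed
  have mem: "x \<in> own j" if "(j, x) \<in> final_matching r own" for j x
    using that highest_own[of j] unfolding final_matching_def labelled_def
    by (cases "own j = {}") auto
  show sub: "final_matching r own \<subseteq> E"
  proof
    fix z assume z: "z \<in> final_matching r own"
    then have "snd z \<in> E `` {fst z}" using mem[of "fst z" "snd z"] own(1)[of "fst z"] by auto
    then show "z \<in> E" by simp
  qed
  have "j \<in> Domain (final_matching r own)" if j: "j \<in> Domain E" for j
  proof (cases "labelled own j")
    case True
    then show ?thesis unfolding final_matching_def by blast
  next
    case False
    obtain x where "x \<in> own j" using own(2)[OF j] by blast
    then have "own j = {x}" using card_le_one_eq[OF fin] False unfolding labelled_def by blast
    then show ?thesis using False unfolding final_matching_def by blast
  qed
  then show "Domain (final_matching r own) = Domain E" using sub by blast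
qed

end

theorem theorem4p3:
  fixes N :: "'a set" and Ob :: "'o set" and C :: "('a, 'o) preferences"
    and \<sigma> :: "'a list" and r :: "('o \<times> 'o) set"
    and \<mu>1 \<mu>2 :: "('a \<times> 'o) set"
  assumes "house_allocation N Ob C"
    and "distinct \<sigma>" and "set \<sigma> = N"
    and "strict_linear_order_on Ob r"
    and "sdmt1 C \<sigma> \<mu>1"
    and "sdmt2 Ob C r \<sigma> \<mu>2"
  shows "Domain \<mu>1 = Domain \<mu>2 \<and>
    (\<forall>i x y. (i, x) \<in> \<mu>1 \<and> (i, y) \<in> \<mu>2 \<longrightarrow> (\<exists>k\<ge>1. x \<in> C i k \<and> y \<in> C i k))"
proof -
  interpret house_allocation N Ob C by fact
  \<comment> \<open>No choice of either algorithm enters this graph; both runs are compared with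
    it.\<close>
  define E where "E = fold (serial_step C) \<sigma> {}"
  obtain E1 where "sdmt1_run C \<sigma> {} {} E1 \<mu>1" using assms(5) unfolding sdmt1_def by blast
  from sdmt1_run_fold[OF this] have 1: "matches_all E \<mu>1"
    using assms(2,3) unfolding E_def by (auto simp: matches_all_def)
  obtain own where own: "sdmt2_run Ob C r {} \<sigma> (\<lambda>_. {}) own" "\<mu>2 = final_matching r own"
    using assms(6) unfolding sdmt2_def by blast
  have 2: "allocates C E own" "Domain E \<subseteq> N"
    using sdmt2_run_fold[OF own(1) assms(4), of "{}"] assms(2,3)
    unfolding E_def by (simp_all add: allocates_def)
  note 3 = final_matching_own[OF 2 assms(4), folded own(2)]
  have "\<exists>k\<ge>1. x \<in> C i k \<and> y \<in> C i k" if "(i, x) \<in> \<mu>1" "(i, y) \<in> \<mu>2" for i x y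
  proof -
    have xy: "(i, x) \<in> E" "(i, y) \<in> E" using that 1 3(2) unfolding matches_all_def by blast+
    \<comment> \<open>\<open>x\<close> and \<open>y\<close> are both neighbours of \<open>i\<close>
      in \<open>E\<close>, and these neighbours form a single class.\<close>
    then obtain k where "1 \<le> k" "E `` {i} = C i k" using 2(1) unfolding allocates_def by blast
    then show ?thesis using xy by blast
  qed
  then show ?thesis using 1 3(1) unfolding matches_all_def by blast
qed

end
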